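(* Let $\Psi:\mathbb{Q}[x]\to\mathbb{Q}$ be the linear form with $\Psi(x^n)=B_n$, where $\frac{t}{e^t-1}=\sum_{n\ge0}B_n\frac{t^n}{n!}$, and let $\mathscr{R}^+_n=\Psi\!\left(\binom{x+2}{2}^n\right)$ for $n\ge0$. Let $(R_n)_{n\ge0}$ be the Racah polynomials with parameters $(\alpha,\beta,\gamma,\delta)=(2,1/2,2,0)$, and let $\Lambda$ be the unique linear form on $\mathbb{Q}[y]$ with $\Lambda(1)=1$ and $\Lambda(R_n(y-2))=0$ for all $n>0$. Then $\Lambda(y^n)=2^n\mathscr{R}^+_{n+3}/\mathscr{R}^+_3$ for all $n\ge 0$, i.e. the numbers $(2^n\mathscr{R}^+_{n+3}/\mathscr{R}^+_3)_{n\ge0}$ are the moments of the orthogonal polynomials $(R_n(y-2))_{n\ge0}$.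
   Context: For parameters $\alpha,\beta,\gamma,\delta$, the Racah polynomial $R_n$ is the polynomial of degree $n$ in a variable $y$ such that, with $\lambda(x)=x(x+\gamma+\delta+1)$, $$R_n(\lambda(x))=\sum_{k=0}^{n}\frac{(-n)_k(n+\alpha+\beta+1)_k(-x)_k(x+\gamma+\delta+1)_k}{(\alpha+1)_k(\beta+\delta+1)_k(\gamma+1)_k\,k!},$$ where $(a)_k=a(a+1)\cdots(a+k-1)$ is the Pochhammer symbol. The "moments" of the family are $\Lambda(y^n)$, $n\ge 0$. *)

theory Defs
  imports "HOL-Computational_Algebra.Computational_Algebra"
begin

text \<open>With this generating function, \<open>bernoulli_number 1 = - 1/2\<close>.\<close>

definition bernoulli_number :: "nat \<Rightarrow> rat" where
  "bernoulli_number n = fact n * fps_nth (fps_X / (fps_exp 1 - 1)) n"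

abbreviation linear_form :: "(rat poly \<Rightarrow> rat) \<Rightarrow> bool" where
  "linear_form \<equiv> Vector_Spaces.linear smult (*)"

definition bernoulli_form :: "rat poly \<Rightarrow> rat" where
  "bernoulli_form p = (\<Sum>i\<le>degree p. coeff p i * bernoulli_number i)"

text \<open>
  The polynomial \<open>binom(x + 2, 2)\<close>, written out because \<open>gchoose\<close> is restricted to
  fields and so does not apply in \<open>rat poly\<close>; see \<open>poly_binom2\<close>.
\<close>

definition binom2 :: "rat poly" where
  "binom2 = smult (1 / 2) ([:2, 1:] * [:1, 1:])"

lemma poly_binom2: "poly binom2 x = (x + 2) gchoose 2"
  by (simp add: binom2_def gbinomial_prod_rev numeral_2_eq_2 algebra_simps)

definition R_plus :: "nat \<Rightarrow> rat" where
  "R_plus n = bernoulli_form (binom2 ^ n)"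

text \<open>
  The defining identity determines the polynomial, because \<open>x * (x + \<gamma> + \<delta> + 1)\<close> takes
  infinitely many values on a field of characteristic zero. A polynomial of degree \<open>n\<close>
  satisfying it exists under the nondegeneracy conditions of the lemma
  \<open>racah_poly_unique\<close> below.
\<close>

definition is_racah_poly ::
    "'a::field_char_0 \<Rightarrow> 'a \<Rightarrow> 'a \<Rightarrow> 'a \<Rightarrow> nat \<Rightarrow> 'a poly \<Rightarrow> bool" where
  "is_racah_poly \<alpha> \<beta> \<gamma> \<delta> n R \<longleftrightarrow>
     degree R = n \<and>
     (\<forall>x. poly R (x * (x + \<gamma> + \<delta> + 1)) =
        (\<Sum>k\<le>n. (pochhammer (- of_nat n) k * pochhammer (of_nat n + \<alpha> + \<beta> + 1) k *
                 pochhammer (- x) k * pochhammer (x + \<gamma> + \<delta> + 1) k) /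
                (pochhammer (\<alpha> + 1) k * pochhammer (\<beta> + \<delta> + 1) k *
                 pochhammer (\<gamma> + 1) k * fact k)))"

definition racah_poly ::
    "'a::field_char_0 \<Rightarrow> 'a \<Rightarrow> 'a \<Rightarrow> 'a \<Rightarrow> nat \<Rightarrow> 'a poly" where
  "racah_poly \<alpha> \<beta> \<gamma> \<delta> n = (THE R. is_racah_poly \<alpha> \<beta> \<gamma> \<delta> n R)"

definition is_moment_form :: "(nat \<Rightarrow> rat poly) \<Rightarrow> (rat poly \<Rightarrow> rat) \<Rightarrow> bool" where
  "is_moment_form P L \<longleftrightarrow> linear_form L \<and> L 1 = 1 \<and> (\<forall>n>0. L (P n) = 0)"

lemma linear_form_iff:
  "linear_form L \<longleftrightarrow> (\<forall>p q. L (p + q) = L p + L q) \<and> (\<forall>c p. L (smult c p) = c * L p)"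
proof -
  have "vector_space (smult :: rat \<Rightarrow> rat poly \<Rightarrow> rat poly)"
    by unfold_locales (simp_all add: smult_add_left smult_add_right)
  moreover have "vector_space ((*) :: rat \<Rightarrow> rat \<Rightarrow> rat)"
    by unfold_locales (simp_all add: algebra_simps)
  ultimately show ?thesis
    unfolding Vector_Spaces.linear_iff by blast
qed

lemma bernoulli_number_gf:
  "Abs_fps (\<lambda>n. bernoulli_number n / fact n) * (fps_exp 1 - 1) = fps_X"
proof -
  have nz: "fps_exp 1 - 1 \<noteq> (0 :: rat fps)"
  proof
    assume "fps_exp 1 - 1 = (0 :: rat fps)"
    then have "fps_nth (fps_exp 1 - 1 :: rat fps) 1 = 0" by simp
    then show False by simp
  qed
  have "subdegree (fps_exp 1 - 1 :: rat fps) \<le> 1"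
    by (rule subdegree_leI) simp
  then have "(fps_exp 1 - 1 :: rat fps) dvd fps_X"
    using nz by (simp add: fps_dvd_iff)
  moreover have "Abs_fps (\<lambda>n. bernoulli_number n / fact n) = fps_X / (fps_exp 1 - 1)"
    by (simp add: fps_eq_iff bernoulli_number_def)
  ultimately show ?thesis by simp
qed

lemma bernoulli_form_eq:
  assumes "degree p \<le> d"
  shows "bernoulli_form p = (\<Sum>i\<le>d. coeff p i * bernoulli_number i)"
  unfolding bernoulli_form_def
  using assms by (intro sum.mono_neutral_left) (auto simp: coeff_eq_0)

lemma linear_form_bernoulli_form: "linear_form bernoulli_form"
proof -
  have "bernoulli_form (p + q) = bernoulli_form p + bernoulli_form q" for p q
  proof -
    define d where "d = max (degree p) (degree q)"
    have d: "degree p \<le> d" "degree q \<le> d" "degree (p + q) \<le> d"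
      by (auto simp: d_def degree_add_le)
    show ?thesis
      unfolding d[THEN bernoulli_form_eq] by (simp add: sum.distrib algebra_simps)
  qed
  moreover have "bernoulli_form (smult c p) = c * bernoulli_form p" for c p
    unfolding bernoulli_form_eq[OF degree_smult_le]
    by (simp add: bernoulli_form_def sum_distrib_left mult.assoc)
  ultimately show ?thesis
    unfolding linear_form_iff by blast
qed

lemma bernoulli_form_monom: "bernoulli_form (monom 1 n) = bernoulli_number n"
proof -
  have "bernoulli_form (monom 1 n) = (\<Sum>i\<le>n. coeff (monom 1 n) i * bernoulli_number i)"
    by (rule bernoulli_form_eq) (simp add: degree_monom_eq)
  also have "\<dots> = (\<Sum>i\<le>n. if i = n then bernoulli_number i else 0)"
    by (intro sum.cong) auto
  finally show ?thesis by simp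
qed

lemma pochhammer_racah_pair:
  fixes x :: "'a::field_char_0"
  shows "pochhammer (- x) k * pochhammer (x + \<gamma> + \<delta> + 1) k =
    poly (\<Prod>j<k. [:of_nat j * (of_nat j + \<gamma> + \<delta> + 1), -1:]) (x * (x + \<gamma> + \<delta> + 1))"
proof (induction k)
  case (Suc k)
  then show ?case
    by (simp add: pochhammer_Suc algebra_simps)
qed simp

lemma racah_poly_unique:
  fixes \<alpha> \<beta> \<gamma> \<delta> :: "'a::field_char_0"
  assumes "pochhammer (\<alpha> + 1) n \<noteq> 0" "pochhammer (\<beta> + \<delta> + 1) n \<noteq> 0"
    and "pochhammer (\<gamma> + 1) n \<noteq> 0" "pochhammer (of_nat n + \<alpha> + \<beta> + 1) n \<noteq> 0"
  shows "\<exists>!R. is_racah_poly \<alpha> \<beta> \<gamma> \<delta> n R"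
proof -
  define c where "c k = pochhammer (- of_nat n) k * pochhammer (of_nat n + \<alpha> + \<beta> + 1) k /
    (pochhammer (\<alpha> + 1) k * pochhammer (\<beta> + \<delta> + 1) k * pochhammer (\<gamma> + 1) k * fact k)" for k
  define q where "q k = (\<Prod>j<k. [:of_nat j * (of_nat j + \<gamma> + \<delta> + 1), -1:])" for k
  define R where "R = (\<Sum>k\<le>n. smult (c k) (q k))"
  have deg_q: "degree (q k) = k" for k
    unfolding q_def by (subst degree_prod_eq_sum_degree) auto
  have "pochhammer (- of_nat n) n \<noteq> (0 :: 'a)"
    by (simp add: pochhammer_of_nat_eq_0_iff)
  then have cn: "c n \<noteq> 0"
    using assms by (simp add: c_def)
  have "coeff R n = (\<Sum>k\<le>n. if k = n then c n * coeff (q n) n else 0)"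
    unfolding R_def coeff_sum
  proof (intro sum.cong refl)
    fix k assume "k \<in> {..n}"
    then show "coeff (smult (c k) (q k)) n = (if k = n then c n * coeff (q n) n else 0)"
      by (cases "k = n") (auto simp: coeff_eq_0 deg_q)
  qed
  moreover have "q n \<noteq> 0"
    by (auto simp: q_def)
  then have "coeff (q n) n \<noteq> 0"
    using leading_coeff_neq_0[of "q n"] by (simp add: deg_q)
  then have "(\<Sum>k\<le>n. if k = n then c n * coeff (q n) n else 0) \<noteq> 0"
    using cn by simp
  ultimately have "n \<le> degree R"
    by (intro le_degree) simp
  moreover have "degree R \<le> n"
    unfolding R_def by (intro degree_sum_le) (auto intro!: order.trans[OF degree_smult_le] simp: deg_q)
  ultimately have "degree R = n" by simp
  moreover have "poly R (x * (x + \<gamma> + \<delta> + 1)) =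
        (\<Sum>k\<le>n. (pochhammer (- of_nat n) k * pochhammer (of_nat n + \<alpha> + \<beta> + 1) k *
                 pochhammer (- x) k * pochhammer (x + \<gamma> + \<delta> + 1) k) /
                (pochhammer (\<alpha> + 1) k * pochhammer (\<beta> + \<delta> + 1) k *
                 pochhammer (\<gamma> + 1) k * fact k))" for x
    unfolding R_def poly_sum
    by (intro sum.cong refl)
       (simp add: c_def q_def mult.assoc pochhammer_racah_pair)
  ultimately have ex: "is_racah_poly \<alpha> \<beta> \<gamma> \<delta> n R"
    unfolding is_racah_poly_def by blast
  show ?thesis
  proof (rule ex1I[of _ R])
    show "is_racah_poly \<alpha> \<beta> \<gamma> \<delta> n R" by (fact ex)
  next
    fix S assume S: "is_racah_poly \<alpha> \<beta> \<gamma> \<delta> n S"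
    have "poly (pcompose (S - R) [:0, \<gamma> + \<delta> + 1, 1:]) x = poly 0 x" for x
    proof -
      have *: "x * (\<gamma> + \<delta> + 1 + x) = x * (x + \<gamma> + \<delta> + 1)"
        by (simp add: algebra_simps)
      show ?thesis
        using ex S by (simp add: poly_pcompose is_racah_poly_def *)
    qed
    then have "pcompose (S - R) [:0, \<gamma> + \<delta> + 1, 1:] = 0"
      by (subst poly_eq_poly_eq_iff[symmetric]) auto
    then have "S - R = 0"
      by (rule pcompose_eq_0) simp
    then show "S = R" by simp
  qed
qed

lemma is_racah_poly_racah_poly: "is_racah_poly 2 (1/2) 2 0 n (racah_poly 2 (1/2) 2 0 n :: rat poly)"
  unfolding racah_poly_def
proof (rule theI', rule racah_poly_unique)
  have pos: "pochhammer a n \<noteq> 0" if "a > 0" for a :: rat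
    using pochhammer_pos[OF that, of n] by simp
  show "pochhammer (2 + 1) n \<noteq> (0 :: rat)" "pochhammer (1/2 + 0 + 1) n \<noteq> (0 :: rat)"
    "pochhammer (2 + 1) n \<noteq> (0 :: rat)" "pochhammer (of_nat n + 2 + 1/2 + 1) n \<noteq> (0 :: rat)"
    by (rule pos, simp add: add_nonneg_pos)+
qed

end

theory Submission
  imports Defs
begin

text \<open>
  Put \<open>\<Lambda>(p) = \<Psi>(b\<^sup>3 p(2b)) / \<Psi>(b\<^sup>3)\<close> with \<open>b = binom(x + 2, 2)\<close>; since \<open>2b - 2 = x(x + 3)\<close>, the claim
  is that \<open>\<Psi>(b\<^sup>3 R\<^sub>n(x(x + 3)))\<close> vanishes for \<open>n > 0\<close>. The only property of \<open>\<Psi>\<close> that is needed is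
  \<open>\<Psi>(p(x + 1)) = \<Psi>(p) + p'(0)\<close>. Translating by one step and applying Gosper summation gives
  \<open>\<Psi>(b\<^sup>3 (-x)\<^sub>k (x + 3)\<^sub>k) = \<Psi>(b\<^sup>3) (3)\<^sub>k\<^sup>2 (3/2)\<^sub>k / (9/2)\<^sub>k\<close>. This cancels the denominators
  of \<open>R\<^sub>n\<close>, and the remaining sum is zero by the Chu-Vandermonde identity.
\<close>

section \<open>Linear forms on polynomials\<close>

lemma linear_form_sum:
  assumes "linear_form L"
  shows "L (sum f S) = (\<Sum>i\<in>S. L (f i))"
proof -
  have "L 0 = 0"
    using assms unfolding linear_form_iff by (metis smult_0_left mult_zero_left)
  with assms show ?thesis
    unfolding linear_form_iff by (induction S rule: infinite_finite_induct) auto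
qed

lemma linear_form_diff:
  assumes "linear_form L"
  shows "L (p - q) = L p - L q"
proof -
  have "L (p + smult (- 1) q) = L p + (- 1) * L q"
    using assms unfolding linear_form_iff by metis
  then show ?thesis by simp
qed

text \<open>Subtracting a multiple of \<open>Q (degree p)\<close> cancels the leading term of
  \<open>p\<close>, so strong induction on the degree applies.\<close>

lemma linear_form_eqI:
  assumes L: "linear_form L" and M: "linear_form M"
    and deg: "\<And>n. degree (Q n) = n" and eq: "\<And>n. L (Q n) = M (Q n)"
    and nz: "Q 0 \<noteq> 0"
  shows "L = M"
proof
  have zero: "L 0 = 0" "M 0 = 0"
    using linear_form_sum[OF L, of _ "{}"] linear_form_sum[OF M, of _ "{}"] by auto
  \<comment> \<open>The zero polynomial has degree 0, so \<open>deg\<close> excludes it only for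
    positive indices.\<close>
  have Qnz: "Q n \<noteq> 0" for n
    using deg[of n] nz by (cases "n = 0") auto
  fix p
  show "L p = M p"
  proof (induction "degree p" arbitrary: p rule: less_induct)
    case less
    define c where "c = lead_coeff p / lead_coeff (Q (degree p))"
    define r where "r = p - smult c (Q (degree p))"
    have p: "p = r + smult c (Q (degree p))" by (simp add: r_def)
    have lc: "lead_coeff (Q (degree p)) \<noteq> 0"
      using Qnz by simp
    have "degree r \<le> degree p"
      unfolding r_def by (intro degree_diff_le) (auto intro: order.trans[OF degree_smult_le] simp: deg)
    moreover have "coeff r (degree p) = 0"
      using lc by (simp add: r_def c_def deg)
    \<comment> \<open>For constant \<open>p\<close> the degree cannot drop, but then
      \<open>r = 0\<close>.\<close>
    ultimately have "r = 0 \<or> degree r < degree p"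
      by (metis le_neq_implies_less leading_coeff_0_iff)
    then have "L r = M r"
      using less zero by auto
    then show ?case
      by (subst (1 2) p) (use L M eq in \<open>simp add: linear_form_iff\<close>)
  qed
qed

section \<open>Translation of the Bernoulli form\<close>

text \<open>Compare coefficients in B(t) e^t = B(t) + t, where B(t) is the exponential generating
  function of the Bernoulli numbers.\<close>

lemma bernoulli_number_binomial_sum:
  "(\<Sum>i\<le>n. of_nat (n choose i) * bernoulli_number i) = bernoulli_number n + (if n = 1 then 1 else 0)"
proof -
  let ?B = "Abs_fps (\<lambda>n. bernoulli_number n / fact n)"
  have "?B * fps_exp 1 = ?B + fps_X"
    using bernoulli_number_gf by (simp add: algebra_simps)
  then have "fps_nth (?B * fps_exp 1) n = fps_nth (?B + fps_X) n" by simp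
  then have "(\<Sum>i\<le>n. bernoulli_number i / fact i * (1 / fact (n - i)))
      = bernoulli_number n / fact n + (if n = 1 then 1 else 0)"
    by (simp add: fps_mult_nth atLeast0AtMost)
  then have "fact n * (\<Sum>i\<le>n. bernoulli_number i / fact i * (1 / fact (n - i)))
      = fact n * (bernoulli_number n / fact n + (if n = 1 then 1 else 0))" by simp
  moreover have "fact n * (\<Sum>i\<le>n. bernoulli_number i / fact i * (1 / fact (n - i)))
      = (\<Sum>i\<le>n. of_nat (n choose i) * bernoulli_number i)"
    unfolding sum_distrib_left by (intro sum.cong refl) (simp add: binomial_fact)
  ultimately show ?thesis
    by (auto simp: algebra_simps)
qed

text \<open>By linearity monomials suffice, and there the binomial recurrence of the Bernoulli
  numbers applies. The term \<open>coeff p 1\<close> is p'(0).\<close>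

lemma bernoulli_form_shift:
  "bernoulli_form (pcompose p [:1, 1:]) = bernoulli_form p + coeff p 1"
proof -
  have lin: "\<And>p q. bernoulli_form (p + q) = bernoulli_form p + bernoulli_form q"
    "\<And>c p. bernoulli_form (smult c p) = c * bernoulli_form p"
    using linear_form_bernoulli_form unfolding linear_form_iff by auto
  have "(\<lambda>p. bernoulli_form (pcompose p [:1, 1:])) = (\<lambda>p. bernoulli_form p + coeff p 1)"
  proof (rule linear_form_eqI[where Q = "\<lambda>n. monom 1 n"])
    show "linear_form (\<lambda>p. bernoulli_form (pcompose p [:1, 1:]))"
      "linear_form (\<lambda>p. bernoulli_form p + coeff p 1)"
      unfolding linear_form_iff by (simp_all add: lin pcompose_add pcompose_smult algebra_simps)
    fix n
    have *: "pcompose (monom 1 n) [:1, 1:] = ([:1, 1:] ^ n :: rat poly)"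
      by (rule poly_ext) (simp add: poly_pcompose poly_monom)
    have "bernoulli_form ([:1, 1:] ^ n) = (\<Sum>i\<le>n. of_nat (n choose i) * bernoulli_number i)"
      by (subst bernoulli_form_eq[of _ n])
         (auto simp: degree_linear_power coeff_linear_poly_power intro!: sum.cong)
    then show "bernoulli_form (pcompose (monom 1 n) [:1, 1:])
        = bernoulli_form (monom 1 n) + coeff (monom 1 n) 1"
      by (simp add: * bernoulli_number_binomial_sum bernoulli_form_monom)
  qed (auto simp: degree_monom_eq)
  then show ?thesis by meson
qed

section \<open>Gosper summation for symmetric products\<close>

text \<open>The polynomial \<open>(-x)\<^sub>k (x + 1)\<^sub>k\<close>.\<close>

definition sym_poch :: "nat \<Rightarrow> rat poly" where
  "sym_poch k = (\<Prod>j<k. [:of_nat j * (of_nat j + 1), - 1, - 1:])"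

lemma poly_sym_poch:
  "poly (sym_poch (Suc k)) x = poly (sym_poch k) x * ((of_nat k - x) * (x + 1 + of_nat k))"
  by (simp add: sym_poch_def algebra_simps)

lemma poly_sym_poch_1: "poly (sym_poch 1) x = - x * (x + 1)"
  by (simp add: sym_poch_def algebra_simps)

text \<open>Translation changes only the end factors of (-x)_k and (x + 1)_k; without quotients the
  relation holds for every x.\<close>

lemma poly_sym_poch_shift:
  "(x + 1 - of_nat k) * poly (sym_poch k) (x + 1) = (x + 1 + of_nat k) * poly (sym_poch k) x"
proof (induction k)
  case (Suc k)
  have "(x + 1 - of_nat (Suc k)) * poly (sym_poch (Suc k)) (x + 1)
      = (x - of_nat k) * (- (x + 2 + of_nat k)) * ((x + 1 - of_nat k) * poly (sym_poch k) (x + 1))"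
    by (simp add: poly_sym_poch algebra_simps)
  then show ?case
    unfolding Suc.IH by (simp add: poly_sym_poch algebra_simps)
qed (simp add: sym_poch_def)

lemma bernoulli_form_sym_poch_rec:
  "bernoulli_form (sym_poch 1 * sym_poch (Suc j)) =
    of_nat ((j + 1) * (j + 2) * (2 * j + 1)) / of_nat (2 * j + 5) *
    bernoulli_form (sym_poch 1 * sym_poch j)"
proof -
  define d :: rat where "d = of_nat (2 * j + 5)"
  define c :: rat where "c = of_nat ((j + 1) * (j + 2) * (2 * j + 1)) / d"
  have d: "d \<noteq> 0" "d = 2 * of_nat j + 5"
    unfolding d_def of_nat_eq_0_iff by simp_all
  have c: "d * c = (of_nat j + 1) * (of_nat j + 2) * (2 * of_nat j + 1)"
    unfolding c_def times_divide_eq_right nonzero_mult_div_cancel_left[OF d(1)]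
    by (simp add: algebra_simps)
  \<comment> \<open>The antidifference produced by Gosper's algorithm.\<close>
  define F :: "rat poly" where
    "F = smult (- 1 / d) ([:0, 1:] * [:- of_nat j, 1:] * [:- 1, 1:] * (sym_poch 1 * sym_poch j))"
  have "pcompose F [:1, 1:] - F = sym_poch 1 * sym_poch (Suc j) - smult c (sym_poch 1 * sym_poch j)"
  proof (rule poly_ext)
    fix x
    let ?a = "poly (sym_poch j) x" and ?J = "of_nat j :: rat"
    \<comment> \<open>The factor y - j of \<open>F\<close> becomes x + 1 - j after translation, so
      this relation eliminates \<open>poly (sym_poch j) (x + 1)\<close>.\<close>
    have shift: "(x + 1 - ?J) * poly (sym_poch j) (x + 1) = (x + 1 + ?J) * ?a"
      by (rule poly_sym_poch_shift)
    have F: "d * poly F y = y * (y - ?J) * (y - 1) * (y * (y + 1) * poly (sym_poch j) y)" for y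
    proof -
      have "d * poly F y = d * (- 1 / d) * (y * (y - ?J) * (y - 1) * (- y * (y + 1) * poly (sym_poch j) y))"
        unfolding F_def poly_smult poly_mult poly_sym_poch_1 by (simp add: mult_ac)
      then show ?thesis
        using d(1) by simp
    qed
    have "d * poly (pcompose F [:1, 1:] - F) x = d * poly F (x + 1) - d * poly F x"
      by (simp add: poly_pcompose add.commute right_diff_distrib)
    also have "\<dots> = x * (x + 1) * (x + 1) * (x + 2) * ((x + 1 - ?J) * poly (sym_poch j) (x + 1))
        - x * (x - ?J) * (x - 1) * (x * (x + 1) * ?a)"
      unfolding F by algebra
    also have "\<dots> = d * poly (sym_poch 1 * sym_poch (Suc j)) x
        - (d * c) * poly (sym_poch 1 * sym_poch j) x"
      unfolding shift c poly_mult poly_sym_poch poly_sym_poch_1 unfolding d(2)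
      by algebra
    also have "\<dots> = d * poly (sym_poch 1 * sym_poch (Suc j) - smult c (sym_poch 1 * sym_poch j)) x"
      by (simp add: algebra_simps)
    finally show "poly (pcompose F [:1, 1:] - F) x
        = poly (sym_poch 1 * sym_poch (Suc j) - smult c (sym_poch 1 * sym_poch j)) x"
      using d by simp
  qed
  \<comment> \<open>\<open>F\<close> contains the factor x twice, from \<open>[:0, 1:]\<close> and
    from \<open>sym_poch 1\<close>, so F'(0) = 0 and translation preserves its Bernoulli
    form.\<close>
  moreover have "coeff F 1 = 0"
    by (simp add: F_def sym_poch_def coeff_pCons split: nat.split)
  then have "bernoulli_form (pcompose F [:1, 1:] - F) = 0"
    by (simp add: linear_form_diff[OF linear_form_bernoulli_form] bernoulli_form_shift)
  ultimately have "bernoulli_form (sym_poch 1 * sym_poch (Suc j)) =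
      bernoulli_form (smult c (sym_poch 1 * sym_poch j))"
    by (simp add: linear_form_diff[OF linear_form_bernoulli_form])
  then show ?thesis
    using linear_form_bernoulli_form by (simp add: linear_form_iff c_def d_def)
qed

text \<open>The polynomial -x(x + 1) is the difference of (x - x^3)/3, whose derivative at 0 is
  1/3.\<close>

lemma bernoulli_form_sym_poch_0: "bernoulli_form (sym_poch 1 * sym_poch 0) = 1 / 3"
proof -
  define F :: "rat poly" where "F = [:0, 1 / 3, 0, - 1 / 3:]"
  have "pcompose F [:1, 1:] - F = sym_poch 1 * sym_poch 0"
    by (simp add: F_def sym_poch_def pcompose_pCons)
  moreover have "bernoulli_form (pcompose F [:1, 1:] - F) = 1 / 3"
    by (simp add: linear_form_diff[OF linear_form_bernoulli_form] bernoulli_form_shift F_def)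
  ultimately show ?thesis by simp
qed

text \<open>The last factor of \<open>sym_poch (k + 2)\<close> is (k + 1 - x)(x + k + 2) = (k + 1)(k
  + 2) - x(x + 1), so a further factor \<open>sym_poch 1\<close> can be traded for a higher
  index.\<close>

lemma bernoulli_form_sym_poch_sq:
  "bernoulli_form ((sym_poch 1)\<^sup>2 * sym_poch (Suc k)) =
    2 * of_nat (k + 2) / of_nat (2 * k + 7) * bernoulli_form (sym_poch 1 * sym_poch (Suc k))"
proof -
  define c :: rat where "c = (of_nat k + 1) * (of_nat k + 2)"
  have nz: "of_nat (2 * k + 7) \<noteq> (0 :: rat)"
    unfolding of_nat_eq_0_iff by simp
  have "(sym_poch 1)\<^sup>2 * sym_poch (Suc k)
      = sym_poch 1 * sym_poch (Suc (Suc k)) - smult c (sym_poch 1 * sym_poch (Suc k))"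
  proof (rule poly_ext)
    fix x
    show "poly ((sym_poch 1)\<^sup>2 * sym_poch (Suc k)) x
      = poly (sym_poch 1 * sym_poch (Suc (Suc k)) - smult c (sym_poch 1 * sym_poch (Suc k))) x"
      by (simp add: poly_sym_poch_1 poly_sym_poch[of "Suc k"] c_def del: One_nat_def)
         (simp add: algebra_simps power2_eq_square)
  qed
  then have "bernoulli_form ((sym_poch 1)\<^sup>2 * sym_poch (Suc k)) =
      bernoulli_form (sym_poch 1 * sym_poch (Suc (Suc k)))
      - c * bernoulli_form (sym_poch 1 * sym_poch (Suc k))"
    using linear_form_bernoulli_form
    by (simp add: linear_form_diff[OF linear_form_bernoulli_form]) (simp add: linear_form_iff)
  then show ?thesis
    unfolding bernoulli_form_sym_poch_rec[of "Suc k"] c_def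
    using nz by (simp add: field_simps)
qed

text \<open>The ratio is written as that of consecutive terms of (3)_k^2 (3/2)_k / (9/2)_k.\<close>

lemma bernoulli_form_sym_poch_sq_rec:
  "bernoulli_form ((sym_poch 1)\<^sup>2 * sym_poch (Suc (Suc k))) =
    (of_nat k + 3)\<^sup>2 * (of_nat k + 3 / 2) / (of_nat k + 9 / 2) *
    bernoulli_form ((sym_poch 1)\<^sup>2 * sym_poch (Suc k))"
proof -
  have nz: "2 * of_nat k + 7 \<noteq> (0 :: rat)" "2 * of_nat k + 9 \<noteq> (0 :: rat)"
    using of_nat_0_le_iff[of k, where ?'a = rat] by linarith+
  have half: "(of_nat k + 3 / 2) / (of_nat k + 9 / 2) = (2 * of_nat k + 3) / (2 * of_nat k + 9 :: rat)"
    using nz by (simp add: divide_simps) (simp add: algebra_simps)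
  show ?thesis
    unfolding bernoulli_form_sym_poch_sq bernoulli_form_sym_poch_rec[of "Suc k"]
      times_divide_eq_right[symmetric] half
    using nz by (simp add: divide_simps power2_eq_square) (simp add: algebra_simps)
qed

section \<open>Evaluation on the Racah basis\<close>

text \<open>The part of the k-th Racah summand that depends on x when \<gamma> + \<delta> + 1 = 3;
  each factor is (j - x)(x + 3 + j).\<close>

definition racah_basis :: "nat \<Rightarrow> rat poly" where
  "racah_basis k = (\<Prod>j<k. [:of_nat j * (of_nat j + 3), - 3, - 1:])"

lemma poly_racah_basis:
  "poly (racah_basis k) x = pochhammer (- x) k * pochhammer (x + 3) k"
  by (induction k) (simp_all add: racah_basis_def pochhammer_Suc algebra_simps)

text \<open>Splitting off the first factors of (-x - 1)_(k+1) and (x + 2)_(k+1) leaves (-x)_k (x +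
  3)_k.\<close>

lemma poly_sym_poch_racah_basis:
  "poly (sym_poch (Suc k)) (x + 1) = - (x + 1) * (x + 2) * poly (racah_basis k) x"
proof (induction k)
  case 0
  show ?case by (simp add: racah_basis_def sym_poch_def algebra_simps)
next
  case (Suc k)
  have "poly (racah_basis (Suc k)) x = poly (racah_basis k) x * ((of_nat k - x) * (x + 3 + of_nat k))"
    by (simp add: racah_basis_def algebra_simps)
  then show ?case
    unfolding poly_sym_poch[of "Suc k"] Suc.IH by simp
qed

text \<open>Translation turns \<open>(sym_poch 1)\<^sup>2\<close> and the factor split off above
  into -((x + 1)(x + 2))^3 = -8 \<open>binom2 ^ 3\<close>.\<close>

lemma bernoulli_form_racah_basis:
  "bernoulli_form (binom2 ^ 3 * racah_basis k) =
    - 1 / 8 * bernoulli_form ((sym_poch 1)\<^sup>2 * sym_poch (Suc k))"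
proof -
  let ?p = "(sym_poch 1)\<^sup>2 * sym_poch (Suc k)"
  have "binom2 ^ 3 * racah_basis k = smult (- 1 / 8) (pcompose ?p [:1, 1:])"
  proof (rule poly_ext)
    fix x
    have "poly (pcompose ?p [:1, 1:]) x = (poly (sym_poch 1) (x + 1))\<^sup>2 * poly (sym_poch (Suc k)) (x + 1)"
      by (simp add: poly_pcompose add.commute)
    also have "\<dots> = (- ((x + 1) * (x + 2))) ^ 3 * poly (racah_basis k) x"
      unfolding poly_sym_poch_racah_basis poly_sym_poch_1
      by (simp add: power2_eq_square power3_eq_cube algebra_simps)
    finally show "poly (binom2 ^ 3 * racah_basis k) x = poly (smult (- 1 / 8) (pcompose ?p [:1, 1:])) x"
      by (simp add: binom2_def power3_eq_cube algebra_simps)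
  qed
  \<comment> \<open>Divisibility by x^2 removes the correction term of the translation.\<close>
  moreover have "coeff ?p 1 = 0"
  proof -
    have "(sym_poch 1)\<^sup>2 = [:0, 0, 1:] * [:1, 1:]\<^sup>2"
      by (simp add: sym_poch_def power2_eq_square)
    then have "?p = [:0, 0, 1:] * ([:1, 1:]\<^sup>2 * sym_poch (Suc k))"
      by (simp only: mult.assoc)
    then show ?thesis by simp
  qed
  ultimately show ?thesis
    using linear_form_bernoulli_form unfolding linear_form_iff
    by (simp only: bernoulli_form_shift) simp
qed

lemma bernoulli_form_racah_basis_closed:
  "bernoulli_form (binom2 ^ 3 * racah_basis k) =
    R_plus 3 * ((pochhammer 3 k)\<^sup>2 * pochhammer (3 / 2) k / pochhammer (9 / 2) k)"
proof (induction k)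
  case 0
  show ?case by (simp add: R_plus_def racah_basis_def)
next
  case (Suc k)
  have "bernoulli_form (binom2 ^ 3 * racah_basis (Suc k)) =
      (of_nat k + 3)\<^sup>2 * (of_nat k + 3 / 2) / (of_nat k + 9 / 2) *
      bernoulli_form (binom2 ^ 3 * racah_basis k)"
    unfolding bernoulli_form_racah_basis bernoulli_form_sym_poch_sq_rec by simp
  then show ?case
    unfolding Suc.IH by (simp add: pochhammer_Suc power2_eq_square add.commute mult_ac)
qed

text \<open>Makes the normalisation of the moment form possible. The recurrences give -1/8 * 4/7 *
  2/5 * 1/3 = -1/105.\<close>

lemma R_plus_3_nonzero: "R_plus 3 \<noteq> 0"
proof -
  have "R_plus 3 = bernoulli_form (binom2 ^ 3 * racah_basis 0)"
    by (simp add: R_plus_def racah_basis_def)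
  also have "\<dots> \<noteq> 0"
    unfolding bernoulli_form_racah_basis bernoulli_form_sym_poch_sq bernoulli_form_sym_poch_rec
      bernoulli_form_sym_poch_0 by simp
  finally show ?thesis .
qed

section \<open>Racah polynomials and their moments\<close>

text \<open>\<open>[:0, 3, 1:]\<close> is \<lambda>(x) = x(x + 3), under which the Racah polynomial
  becomes a combination of the \<open>racah_basis k\<close>.\<close>

lemma bernoulli_form_racah_poly:
  assumes "n > 0"
  shows "bernoulli_form (binom2 ^ 3 * pcompose (racah_poly 2 (1/2) 2 0 n) [:0, 3, 1:]) = 0"
proof -
  define c :: "nat \<Rightarrow> rat" where "c k = pochhammer (- of_nat n) k * pochhammer (of_nat n + 7 / 2) k /
    (pochhammer 3 k * pochhammer (3 / 2) k * pochhammer 3 k * fact k)" for k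
  have "binom2 ^ 3 * pcompose (racah_poly 2 (1/2) 2 0 n) [:0, 3, 1:]
      = (\<Sum>k\<le>n. smult (c k) (binom2 ^ 3 * racah_basis k))"
  proof (rule poly_ext)
    fix x :: rat
    have "poly (pcompose (racah_poly 2 (1/2) 2 0 n) [:0, 3, 1:]) x
        = poly (racah_poly 2 (1/2) 2 0 n) (x * (x + 2 + 0 + 1))"
      by (simp add: poly_pcompose algebra_simps)
    also have "\<dots> = (\<Sum>k\<le>n. c k * poly (racah_basis k) x)"
      using is_racah_poly_racah_poly[of n] unfolding is_racah_poly_def
      by (auto simp: c_def poly_racah_basis add.assoc intro!: sum.cong)
    finally show "poly (binom2 ^ 3 * pcompose (racah_poly 2 (1/2) 2 0 n) [:0, 3, 1:]) x
        = poly (\<Sum>k\<le>n. smult (c k) (binom2 ^ 3 * racah_basis k)) x"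
      by (simp add: poly_sum sum_distrib_left mult_ac)
  qed
  then have "bernoulli_form (binom2 ^ 3 * pcompose (racah_poly 2 (1/2) 2 0 n) [:0, 3, 1:])
      = (\<Sum>k\<le>n. c k * bernoulli_form (binom2 ^ 3 * racah_basis k))"
    using linear_form_bernoulli_form
    by (simp add: linear_form_sum[OF linear_form_bernoulli_form]) (simp add: linear_form_iff)
  also have "\<dots> = R_plus 3 * (\<Sum>k\<le>n. (pochhammer (of_nat n + 7 / 2) k * pochhammer (- of_nat n) k) /
      (of_nat (fact k) * pochhammer (9 / 2) k))"
    unfolding sum_distrib_left
  proof (intro sum.cong refl)
    fix k
    have nz: "pochhammer 3 k \<noteq> (0 :: rat)" "pochhammer (3 / 2) k \<noteq> (0 :: rat)"
      using pochhammer_pos[of "3 :: rat" k] pochhammer_pos[of "3 / 2 :: rat" k] by simp_all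
    show "c k * bernoulli_form (binom2 ^ 3 * racah_basis k) =
        R_plus 3 * ((pochhammer (of_nat n + 7 / 2) k * pochhammer (- of_nat n) k) /
        (of_nat (fact k) * pochhammer (9 / 2) k))"
      using nz by (simp add: bernoulli_form_racah_basis_closed c_def power2_eq_square)
  qed
  \<comment> \<open>This is the terminating series 2F1(-n, n + 7/2; 9/2; 1).\<close>
  also have "(\<Sum>k\<le>n. (pochhammer (of_nat n + 7 / 2) k * pochhammer (- of_nat n) k) /
      (of_nat (fact k) * pochhammer (9 / 2) k))
      = pochhammer (9 / 2 - (of_nat n + 7 / 2)) n / pochhammer (9 / 2 :: rat) n"
    unfolding atLeast0AtMost[symmetric]
  proof (rule Vandermonde_pochhammer, intro ballI)
    fix i assume "i \<in> {0..<n}"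
    show "(9 / 2 :: rat) \<noteq> - of_nat i"
      using of_nat_0_le_iff[of i, where ?'a = rat] by linarith
  qed
  \<comment> \<open>The n factors of (1 - n)_n run from 1 - n up to 0; this is where n > 0
    enters.\<close>
  also have "(9 / 2 - (of_nat n + 7 / 2)) = (- of_nat (n - 1) :: rat)"
    using assms by simp
  also have "pochhammer (- of_nat (n - 1)) n = (0 :: rat)"
    unfolding pochhammer_of_nat_eq_0_iff using assms by simp
  finally show ?thesis by simp
qed

theorem theorem2p5:
  fixes P :: "nat \<Rightarrow> rat poly"
  defines "P \<equiv> \<lambda>n. pcompose (racah_poly 2 (1/2) 2 0 n) [:-2, 1:]"
  shows "(\<exists>!L. is_moment_form P L) \<and>
         (\<forall>L. is_moment_form P L \<longrightarrow>
            (\<forall>n. L (monom 1 n) = 2 ^ n * R_plus (n + 3) / R_plus 3))"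
proof -
  \<comment> \<open>The weight \<open>binom2 ^ 3\<close> raises the index of \<open>R_plus\<close>
    by 3, and substituting \<open>smult 2 binom2\<close> produces 2^n.\<close>
  define M where "M p = bernoulli_form (binom2 ^ 3 * pcompose p (smult 2 binom2)) / R_plus 3" for p
  have lin: "linear_form M"
    using linear_form_bernoulli_form unfolding linear_form_iff M_def
    by (simp add: pcompose_add pcompose_smult algebra_simps add_divide_distrib)
  have one: "M 1 = 1"
    using R_plus_3_nonzero by (simp add: M_def R_plus_def pcompose_1)
  have degP: "degree (P n) = n" for n
    using is_racah_poly_racah_poly[of n] by (simp add: P_def is_racah_poly_def degree_pcompose)
  \<comment> \<open>The orthogonality conditions concern only n > 0; this reduces index 0 to the
    normalisation \<open>L 1 = 1\<close>.\<close>
  have P0: "P 0 = 1"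
  proof -
    have "poly (racah_poly 2 (1/2) 2 0 0) 0 = (1 :: rat)"
      using is_racah_poly_racah_poly[of 0] unfolding is_racah_poly_def
      by (auto dest!: spec[of _ 0])
    moreover have "degree (racah_poly 2 (1/2) 2 0 0 :: rat poly) = 0"
      using is_racah_poly_racah_poly[of 0] unfolding is_racah_poly_def by blast
    ultimately have "racah_poly 2 (1/2) 2 0 0 = (1 :: rat poly)"
      by (auto elim!: degree_eq_zeroE)
    then show ?thesis by (simp add: P_def pcompose_1)
  qed
  have "M (P n) = 0" if "n > 0" for n
  proof -
    have "pcompose (P n) (smult 2 binom2) = pcompose (racah_poly 2 (1/2) 2 0 n) [:0, 3, 1:]"
      unfolding P_def pcompose_assoc[symmetric] by (simp add: pcompose_pCons binom2_def)
    then show ?thesis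
      using bernoulli_form_racah_poly[OF that] by (simp add: M_def)
  qed
  with lin one have mom: "is_moment_form P M"
    by (simp add: is_moment_form_def)
  have uniq: "L = M" if "is_moment_form P L" for L
  proof (rule linear_form_eqI[where Q = P])
    show "L (P n) = M (P n)" for n
      using that mom by (cases "n = 0") (auto simp: is_moment_form_def P0)
  qed (use that lin degP P0 in \<open>auto simp: is_moment_form_def\<close>)
  have "M (monom 1 n) = 2 ^ n * R_plus (n + 3) / R_plus 3" for n
  proof -
    have "binom2 ^ 3 * pcompose (monom 1 n) (smult 2 binom2) = smult (2 ^ n) (binom2 ^ (n + 3))"
      by (rule poly_ext) (simp add: poly_pcompose poly_monom power_mult_distrib power_add)
    then show ?thesis
      using linear_form_bernoulli_form by (simp add: M_def R_plus_def linear_form_iff)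
  qed
  with mom uniq show ?thesis by metis
qed

end
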